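(* Let $n\ge 2$ be an integer and let $\mathrm{M}$ be a matroid on $[n]=\{1,\ldots,n\}$. For any integer $m$ with $0<m<n$ and any real $q$ with $0<q\le 1$, $$\frac{\mathrm{Z}^m_{\mathrm{M}}(q,w)^2}{\binom{n}{m}^2}\ \ge\ \frac{\mathrm{Z}^{m+1}_{\mathrm{M}}(q,w)}{\binom{n}{m+1}}\,\frac{\mathrm{Z}^{m-1}_{\mathrm{M}}(q,w)}{\binom{n}{m-1}}\qquad\text{for all } w\in\mathbb{R}^n_{\ge 0}.$$
   Context: Let $\mathrm{rk}_{\mathrm{M}}:2^{[n]}\to\mathbb{Z}_{\ge 0}$ be the rank function of $\mathrm{M}$ (loops and parallel elements are allowed). For an integer $k\ge 0$, a positive real parameter $q$, and $w=(w_1,\ldots,w_n)$, define $$\mathrm{Z}^k_{\mathrm{M}}(q,w)=\sum_{A\subseteq[n],\ |A|=k} q^{-\mathrm{rk}_{\mathrm{M}}(A)}\prod_{i\in A}w_i .$$ *)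

theory Defs
  imports Complex_Main
begin

locale matroid =
  fixes E :: "'a set" and indep :: "'a set \<Rightarrow> bool"
  assumes finite_ground: "finite E"
    and indep_ground: "indep X \<Longrightarrow> X \<subseteq> E"
    and indep_empty: "indep {}"
    and indep_subset: "indep X \<Longrightarrow> Y \<subseteq> X \<Longrightarrow> indep Y"
    and indep_augment: "indep X \<Longrightarrow> indep Y \<Longrightarrow> card X < card Y \<Longrightarrow>
      \<exists>y \<in> Y - X. indep (insert y X)"

(* Only meaningful for finite A: then Max ranges over a finite set, nonempty since {} is independent. *)
definition matroid_rank :: "('a set \<Rightarrow> bool) \<Rightarrow> 'a set \<Rightarrow> nat" where
  "matroid_rank indep A = Max {card X | X. X \<subseteq> A \<and> indep X}"

definition potts_Z ::
    "'a set \<Rightarrow> ('a set \<Rightarrow> bool) \<Rightarrow> nat \<Rightarrow> real \<Rightarrow> ('a \<Rightarrow> real) \<Rightarrow> real" where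
  "potts_Z E indep k q w =
     (\<Sum>A | A \<subseteq> E \<and> card A = k. q powi (- int (matroid_rank indep A)) * (\<Prod>i\<in>A. w i))"

end

theory Submission
  imports Defs "HOL-Analysis.Convex" "HOL-Library.Multiset"
begin

text \<open>
  Homogenise with an extra variable $z$: the polynomial
  $f = \sum_A q^{-\mathrm{rk}(A)} w_z^{n-|A|} \prod_{i \in A} w_i$ is Lorentzian, that is, the Hessian
  of each of its derivatives satisfies the reversed Cauchy--Schwarz inequality at every positive
  point, and the claim is this inequality for $\partial_z^{n-m-1} f$ in the directions $z$ and
  $w$, in the limit $w_z \to 0$.

  For derivatives of degree 2 the Hessian inequality reduces to
  $(\sum_i u_i)^2 \le N \sum_C (\sum_{i \in C} u_i)^2$, where $C$ runs over the parallel classes of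
  a contraction with $N$ elements. In higher degree, write $K_{ij} = w_i w_j \partial_i \partial_j f$
  and let $P$ be $K$ with rows scaled to sum to 1, self-adjoint for the weights given by the row
  sums. Adding up the inequalities for the $\partial_k f$ gives $P \le P^2$. The
  entry $K_{zi}$ is positive unless row $i$ vanishes, so $P \le c < 1$ on the complement of the
  constants, and there $P \le P^2$ forces $P \le 0$. This needs no eigenvectors: $P \le c$
  improves to $P \le c / (2 - c)$, and iterating drives $c$ to 0.
\<close>

section \<open>Reversed Cauchy--Schwarz inequalities\<close>

definition bilin :: "'a set \<Rightarrow> ('a \<Rightarrow> 'a \<Rightarrow> real) \<Rightarrow> ('a \<Rightarrow> real) \<Rightarrow> ('a \<Rightarrow> real) \<Rightarrow> real" where
  "bilin I K x y = (\<Sum>i\<in>I. \<Sum>j\<in>I. K i j * x i * y j)"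

text \<open>The second vector is fixed to all ones because the factors w_i w_j are absorbed into
  \<open>K\<close>; all ones then stands for the point w at which the Hessian is taken.\<close>

definition reverse_cauchy :: "'a set \<Rightarrow> ('a \<Rightarrow> 'a \<Rightarrow> real) \<Rightarrow> bool" where
  "reverse_cauchy I K \<longleftrightarrow>
     (\<forall>x. bilin I K x x * bilin I K (\<lambda>_. 1) (\<lambda>_. 1) \<le> (bilin I K x (\<lambda>_. 1))\<^sup>2)"

section \<open>Bilinear forms and change of direction\<close>

lemma bilin_commute:
  assumes "\<And>i j. K i j = K j i"
  shows "bilin I K x y = bilin I K y x"
  unfolding bilin_def
  by (subst sum.swap, intro sum.cong refl) (subst assms, simp add: mult_ac)

lemma bilin_combine_left:
  "bilin I K (\<lambda>i. x i + t * y i) z = bilin I K x z + t * bilin I K y z"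
  unfolding bilin_def by (simp add: algebra_simps sum.distrib sum_distrib_left)

lemma bilin_combine_right:
  "bilin I K z (\<lambda>i. x i + t * y i) = bilin I K z x + t * bilin I K z y"
  unfolding bilin_def by (simp add: algebra_simps sum.distrib sum_distrib_left)

lemma bilin_square_combine:
  assumes "\<And>i j. K i j = K j i"
  shows "bilin I K (\<lambda>i. x i + t * y i) (\<lambda>i. x i + t * y i)
    = bilin I K x x + 2 * t * bilin I K x y + t\<^sup>2 * bilin I K y y"
  using bilin_commute[of K I y x, OF assms]
  by (simp add: bilin_combine_left bilin_combine_right algebra_simps power2_eq_square)

text \<open>By \<open>neg\<close>, \<open>K\<close> is negative semidefinite on the
  \<open>K\<close>-orthogonal complement of \<open>e\<close>. Since \<open>e\<close> and
  \<open>u\<close> are not orthogonal, every \<open>x\<close> can be moved into that complement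
  along \<open>u\<close>, which transfers the inequality from the direction \<open>e\<close> to
  \<open>u\<close>.\<close>

lemma reverse_cauchy_from_direction:
  assumes sym: "\<And>i j. K i j = K j i"
    and neg: "\<And>x. bilin I K e e * bilin I K x x \<le> (bilin I K e x)\<^sup>2"
    and e: "bilin I K e e > 0" "bilin I K e u > 0" and u: "bilin I K u u \<ge> 0"
  shows "bilin I K x x * bilin I K u u \<le> (bilin I K x u)\<^sup>2"
proof -
  define t where "t = - (bilin I K e x / bilin I K e u)"
  have "bilin I K e (\<lambda>i. x i + t * u i) = 0"
    unfolding bilin_combine_right using e by (simp add: t_def)
  then have "bilin I K e e * bilin I K (\<lambda>i. x i + t * u i) (\<lambda>i. x i + t * u i) \<le> 0"
    using neg[of "\<lambda>i. x i + t * u i"] by simp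
  then have "bilin I K (\<lambda>i. x i + t * u i) (\<lambda>i. x i + t * u i) \<le> 0"
    using e by (simp add: mult_le_0_iff)
  then have "bilin I K x x + 2 * t * bilin I K x u + t\<^sup>2 * bilin I K u u \<le> 0"
    by (simp add: bilin_square_combine[where K = K, OF sym])
  then have "(bilin I K x x + 2 * t * bilin I K x u + t\<^sup>2 * bilin I K u u) * bilin I K u u \<le> 0"
    using u by (simp add: mult_le_0_iff)
  \<comment> \<open>The square expands to the square of \<open>bilin I K x u\<close> plus exactly
    the terms in \<open>t\<close> of the previous inequality.\<close>
  moreover have "0 \<le> (bilin I K x u + t * bilin I K u u)\<^sup>2" by simp
  ultimately show ?thesis by (simp add: power2_eq_square algebra_simps)
qed

text \<open>Read \<open>K\<close> as edge weights of a graph with degrees \<open>d I i\<close>. The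
  difference of the two quadratic forms is a Dirichlet form, and the edges at \<open>z\<close>,
  which reach every vertex of positive degree, already bound it from below.\<close>

lemma spectral_gap:
  fixes K :: "'a \<Rightarrow> 'a \<Rightarrow> real"
  defines "d \<equiv> \<lambda>I i. \<Sum>j\<in>I. K i j"
  assumes I: "finite I" "z \<in> I" and sym: "\<And>i j. K i j = K j i"
    and nn: "\<And>i j. i \<in> I \<Longrightarrow> j \<in> I \<Longrightarrow> K i j \<ge> 0"
    and hub: "\<And>i. i \<in> I \<Longrightarrow> d I i > 0 \<Longrightarrow> K z i > 0"
  obtains \<delta> where "0 < \<delta>" "\<delta> \<le> 1"
    "\<And>x. (\<Sum>i\<in>I. d I i * x i) = 0 \<Longrightarrow> bilin I K x x \<le> (1 - \<delta>) * (\<Sum>i\<in>I. d I i * (x i)\<^sup>2)"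
proof -
  have d0: "d I i \<ge> 0" if "i \<in> I" for i unfolding d_def using that nn by (simp add: sum_nonneg)
  \<comment> \<open>The inserted 1 keeps the set nonempty and gives
    \<open>\<delta> \<le> 1\<close>.\<close>
  define \<delta> where "\<delta> = Min (insert 1 ((\<lambda>i. K z i / d I i) ` {i \<in> I. d I i > 0}))"
  have \<delta>0: "0 < \<delta>" unfolding \<delta>_def using I hub by (subst Min_gr_iff) auto
  have \<delta>1: "\<delta> \<le> 1" unfolding \<delta>_def using I by (intro Min_le) auto
  have \<delta>K: "\<delta> * d I i \<le> K z i" if "i \<in> I" for i
  proof (cases "d I i > 0")
    case True
    then have "\<delta> \<le> K z i / d I i" unfolding \<delta>_def using that I by (intro Min_le) auto
    then show ?thesis using True by (simp add: field_simps)
  next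
    case False
    then show ?thesis using d0[OF that] nn[OF \<open>z \<in> I\<close> that] by simp
  qed
  have "bilin I K x x \<le> (1 - \<delta>) * (\<Sum>i\<in>I. d I i * (x i)\<^sup>2)" if x: "(\<Sum>i\<in>I. d I i * x i) = 0" for x
  proof -
    have dir: "(\<Sum>i\<in>I. \<Sum>j\<in>I. K i j * (x i - x j)\<^sup>2)
        = 2 * (\<Sum>i\<in>I. d I i * (x i)\<^sup>2) - 2 * bilin I K x x"
    proof -
      have 1: "(\<Sum>i\<in>I. \<Sum>j\<in>I. K i j * (x i)\<^sup>2) = (\<Sum>i\<in>I. d I i * (x i)\<^sup>2)"
        by (simp add: d_def sum_distrib_right)
      have 2: "(\<Sum>i\<in>I. \<Sum>j\<in>I. K i j * (x j)\<^sup>2) = (\<Sum>i\<in>I. d I i * (x i)\<^sup>2)"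
        by (subst sum.swap, subst sym) (rule 1)
      have "(\<Sum>i\<in>I. \<Sum>j\<in>I. K i j * (x i - x j)\<^sup>2)
        = (\<Sum>i\<in>I. \<Sum>j\<in>I. K i j * (x i)\<^sup>2) + (\<Sum>i\<in>I. \<Sum>j\<in>I. K i j * (x j)\<^sup>2) - 2 * bilin I K x x"
        unfolding bilin_def sum_distrib_left sum.distrib[symmetric] sum_subtractf[symmetric]
        by (intro sum.cong refl) (simp add: power2_eq_square algebra_simps)
      then show ?thesis using 1 2 by simp
    qed
    have row: "(\<Sum>j\<in>I. K z j * (x z - x j)\<^sup>2) \<ge> \<delta> * (\<Sum>i\<in>I. d I i * (x i)\<^sup>2)"
    proof -
      \<comment> \<open>The weighted mean of \<open>x\<close> is 0, so recentring at
        \<open>x z\<close> can only increase the weighted sum of squares.\<close>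
      have "(\<Sum>i\<in>I. d I i * (x z - x i)\<^sup>2)
          = (x z)\<^sup>2 * (\<Sum>i\<in>I. d I i) - 2 * x z * (\<Sum>i\<in>I. d I i * x i) + (\<Sum>i\<in>I. d I i * (x i)\<^sup>2)"
        unfolding sum_distrib_left sum.distrib[symmetric] sum_subtractf[symmetric]
        by (intro sum.cong refl) (simp add: power2_eq_square algebra_simps)
      then have "(\<Sum>i\<in>I. d I i * (x i)\<^sup>2) \<le> (\<Sum>i\<in>I. d I i * (x z - x i)\<^sup>2)"
        using x d0 by (simp add: sum_nonneg)
      then have "\<delta> * (\<Sum>i\<in>I. d I i * (x i)\<^sup>2) \<le> \<delta> * (\<Sum>i\<in>I. d I i * (x z - x i)\<^sup>2)"
        using \<delta>0 by simp
      also have "\<dots> \<le> (\<Sum>j\<in>I. K z j * (x z - x j)\<^sup>2)"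
        unfolding sum_distrib_left using \<delta>K
        by (intro sum_mono) (simp add: mult.assoc[symmetric] mult_right_mono)
      finally show ?thesis .
    qed
    \<comment> \<open>Each edge at \<open>z\<close> is counted in the row and again in the column of
      \<open>z\<close>; the diagonal term vanishes.\<close>
    have "(\<Sum>i\<in>I. \<Sum>j\<in>I. K i j * (x i - x j)\<^sup>2) \<ge> 2 * (\<Sum>j\<in>I. K z j * (x z - x j)\<^sup>2)"
    proof -
      have *: "(\<Sum>i\<in>I. \<Sum>j\<in>I. K i j * (x i - x j)\<^sup>2)
        = (\<Sum>j\<in>I. K z j * (x z - x j)\<^sup>2) + (\<Sum>i\<in>I-{z}. \<Sum>j\<in>I. K i j * (x i - x j)\<^sup>2)"
        using I by (subst sum.remove[of I z]) auto
      have "(\<Sum>j\<in>I. K z j * (x z - x j)\<^sup>2) = (\<Sum>j\<in>I-{z}. K j z * (x j - x z)\<^sup>2)"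
        using I by (subst sum.remove[of I z]) (auto simp: power2_commute[of "x z"] sym)
      also have "\<dots> \<le> (\<Sum>i\<in>I-{z}. \<Sum>j\<in>I. K i j * (x i - x j)\<^sup>2)"
        using I nn by (intro sum_mono member_le_sum) auto
      finally show ?thesis using * by simp
    qed
    then show ?thesis using dir row by (simp add: algebra_simps)
  qed
  then show thesis using \<delta>0 \<delta>1 that by blast
qed

text \<open>On vectors of mean zero -1 \<le> P \<le> c, so c - P lies between 0 and 1 + c and (c -
  P)^2 \<le> (1 + c)(c - P). With \<open>sq\<close>, which says P \<le> P^2, this rearranges to (2 -
  c) P \<le> c. A single test vector replaces the spectral decomposition.\<close>

lemma contraction_step:
  fixes K :: "'a \<Rightarrow> 'a \<Rightarrow> real"
  defines "d \<equiv> \<lambda>I i. \<Sum>j\<in>I. K i j"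
  assumes I: "finite I" and sym: "\<And>i j. K i j = K j i"
    and nn: "\<And>i j. i \<in> I \<Longrightarrow> j \<in> I \<Longrightarrow> K i j \<ge> 0"
    and sq: "\<And>x. bilin I K x x \<le> (\<Sum>i\<in>I. (\<Sum>j\<in>I. K i j * x j)\<^sup>2 / d I i)"
    and c: "0 \<le> c" "c < 1"
    and gap: "\<And>x. (\<Sum>i\<in>I. d I i * x i) = 0 \<Longrightarrow> bilin I K x x \<le> c * (\<Sum>i\<in>I. d I i * (x i)\<^sup>2)"
    and x: "(\<Sum>i\<in>I. d I i * x i) = 0"
  shows "bilin I K x x \<le> c / (2 - c) * (\<Sum>i\<in>I. d I i * (x i)\<^sup>2)"
proof -
  define dot where "dot = (\<lambda>x y. \<Sum>i\<in>I. d I i * x i * y i)"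
  have dot2: "(\<Sum>i\<in>I. d I i * (x i)\<^sup>2) = dot x x" for x
    by (simp add: dot_def power2_eq_square mult.assoc)
  have d0: "d I i \<ge> 0" if "i \<in> I" for i unfolding d_def using that nn by (simp add: sum_nonneg)
  \<comment> \<open>A zero row sum forces a zero row, so \<open>dP\<close> also holds where the
    division by 0 returns 0.\<close>
  define P where "P = (\<lambda>i. (\<Sum>j\<in>I. K i j * x j) / d I i)"
  have dP: "d I i * P i = (\<Sum>j\<in>I. K i j * x j)" if i: "i \<in> I" for i
  proof (cases "d I i = 0")
    case True
    then have "K i j = 0" if "j \<in> I" for j
      using nn i that I unfolding d_def by (simp add: sum_nonneg_eq_0_iff)
    then show ?thesis using True by simp
  qed (simp add: P_def)
  have bil: "bilin I K y x = dot y P" for y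
    unfolding bilin_def dot_def
  proof (intro sum.cong refl)
    fix i assume "i \<in> I"
    have "(\<Sum>j\<in>I. K i j * y i * x j) = y i * (\<Sum>j\<in>I. K i j * x j)"
      unfolding sum_distrib_left by (intro sum.cong refl) (simp add: mult_ac)
    then show "(\<Sum>j\<in>I. K i j * y i * x j) = d I i * y i * P i"
      using dP[OF \<open>i \<in> I\<close>] by (simp add: mult_ac)
  qed
  \<comment> \<open>This is (c - P) x. It has mean zero again because the columns of
    \<open>K\<close> have the same sums as its rows.\<close>
  define y where "y = (\<lambda>i. c * x i - P i)"
  have y: "(\<Sum>i\<in>I. d I i * y i) = 0"
  proof -
    have "(\<Sum>i\<in>I. d I i * P i) = (\<Sum>i\<in>I. \<Sum>j\<in>I. K i j * x j)" by (simp add: dP)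
    also have "\<dots> = (\<Sum>j\<in>I. \<Sum>i\<in>I. K j i * x j)" by (subst sum.swap) (simp add: sym)
    also have "\<dots> = (\<Sum>j\<in>I. d I j * x j)" by (simp add: d_def sum_distrib_right)
    finally show ?thesis using x
      by (simp add: y_def right_diff_distrib sum_subtractf mult.left_commute[of _ c] sum_distrib_left[symmetric])
  qed
  \<comment> \<open>The value that maximises -2 s - (1 + c) s^2, the factor of
    \<open>dot y y\<close> in the bound obtained by testing \<open>gap\<close> at x + s y.\<close>
  define s where "s = - (1 / (1 + c))"
  have dot_comm: "dot u v = dot v u" for u v by (simp add: dot_def mult_ac)
  have dot_sq: "dot (\<lambda>i. x i + s * y i) (\<lambda>i. x i + s * y i) = dot x x + 2 * s * dot x y + s\<^sup>2 * dot y y"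
    unfolding dot_def sum_distrib_left sum.distrib[symmetric]
    by (intro sum.cong refl) (simp add: power2_eq_square algebra_simps)
  have yy: "dot y y = c * dot y x - dot y P"
    unfolding dot_def sum_distrib_left sum_subtractf[symmetric]
    by (intro sum.cong refl) (simp add: y_def algebra_simps)
  have yy2: "dot y y = c\<^sup>2 * dot x x - 2 * c * dot x P + dot P P"
    unfolding dot_def sum_distrib_left sum_subtractf[symmetric] sum.distrib[symmetric]
    by (intro sum.cong refl) (simp add: y_def power2_eq_square algebra_simps)
  have PP: "dot P P \<ge> bilin I K x x"
  proof -
    have "dot P P = (\<Sum>i\<in>I. (\<Sum>j\<in>I. K i j * x j)\<^sup>2 / d I i)"
      unfolding dot_def by (intro sum.cong refl) (simp add: dP, simp add: P_def power2_eq_square)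
    then show ?thesis using sq[of x] by simp
  qed
  \<comment> \<open>The bound -1 \<le> P.\<close>
  have low: "- bilin I K y y \<le> dot y y"
  proof -
    have 1: "(\<Sum>i\<in>I. \<Sum>j\<in>I. K i j * (y i)\<^sup>2) = dot y y"
      by (simp add: d_def dot2[symmetric] sum_distrib_right)
    have 2: "(\<Sum>i\<in>I. \<Sum>j\<in>I. K i j * (y j)\<^sup>2) = dot y y"
      by (subst sum.swap, subst sym) (rule 1)
    have "(\<Sum>i\<in>I. \<Sum>j\<in>I. K i j * (y i + y j)\<^sup>2)
        = (\<Sum>i\<in>I. \<Sum>j\<in>I. K i j * (y i)\<^sup>2) + (\<Sum>i\<in>I. \<Sum>j\<in>I. K i j * (y j)\<^sup>2) + 2 * bilin I K y y"
      unfolding bilin_def sum_distrib_left sum.distrib[symmetric]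
      by (intro sum.cong refl) (simp add: power2_eq_square algebra_simps)
    moreover have "(\<Sum>i\<in>I. \<Sum>j\<in>I. K i j * (y i + y j)\<^sup>2) \<ge> 0"
      using nn by (intro sum_nonneg) simp
    ultimately show ?thesis using 1 2 by simp
  qed
  have z: "(\<Sum>i\<in>I. d I i * (x i + s * y i)) = 0"
    using x y by (simp add: distrib_left sum.distrib mult.left_commute[of _ s] sum_distrib_left[symmetric])
  have "bilin I K x x + 2 * s * bilin I K x y + s\<^sup>2 * bilin I K y y
      \<le> c * (dot x x + 2 * s * dot x y + s\<^sup>2 * dot y y)"
    using gap[OF z] unfolding bilin_square_combine[where K = K, OF sym] dot2 dot_sq .
  moreover have "bilin I K x y = c * dot x y - dot y y"
    using yy bil[of y] bilin_commute[of K I x y, OF sym] dot_comm[of x y] by simp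
  ultimately have 3: "2 * s * (- dot y y) + s\<^sup>2 * bilin I K y y
      \<le> c * dot x x - bilin I K x x + c * s\<^sup>2 * dot y y"
    by (simp add: algebra_simps)
  have "s\<^sup>2 * (- bilin I K y y) \<le> s\<^sup>2 * dot y y" using low by (intro mult_left_mono) auto
  then have "- 2 * s * dot y y - (1 + c) * s\<^sup>2 * dot y y \<le> c * dot x x - bilin I K x x"
    using 3 by (simp add: algebra_simps)
  moreover have "(1 + c) * s\<^sup>2 = - s"
    using c by (simp add: s_def power2_eq_square)
  then have "- 2 * s * dot y y - (1 + c) * s\<^sup>2 * dot y y = dot y y / (1 + c)"
    by (simp add: s_def)
  ultimately have "dot y y / (1 + c) \<le> c * dot x x - bilin I K x x"
    by linarith
  then have "dot y y \<le> (1 + c) * (c * dot x x - bilin I K x x)"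
    using c by (simp add: pos_divide_le_eq mult.commute)
  then have "(2 - c) * bilin I K x x \<le> c * dot x x"
    using yy2 PP bil[of x] by (simp add: algebra_simps power2_eq_square)
  then show ?thesis using c unfolding dot2 by (simp add: field_simps)
qed

lemma negative_on_complement:
  fixes K :: "'a \<Rightarrow> 'a \<Rightarrow> real"
  defines "d \<equiv> \<lambda>I i. \<Sum>j\<in>I. K i j"
  assumes I: "finite I" "z \<in> I" and sym: "\<And>i j. K i j = K j i"
    and nn: "\<And>i j. i \<in> I \<Longrightarrow> j \<in> I \<Longrightarrow> K i j \<ge> 0"
    and hub: "\<And>i. i \<in> I \<Longrightarrow> d I i > 0 \<Longrightarrow> K z i > 0"
    and sq: "\<And>x. bilin I K x x \<le> (\<Sum>i\<in>I. (\<Sum>j\<in>I. K i j * x j)\<^sup>2 / d I i)"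
    and x: "(\<Sum>i\<in>I. d I i * x i) = 0"
  shows "bilin I K x x \<le> 0"
proof -
  obtain \<delta> where \<delta>: "0 < \<delta>" "\<delta> \<le> 1"
    and gap: "\<And>x. (\<Sum>i\<in>I. d I i * x i) = 0 \<Longrightarrow> bilin I K x x \<le> (1 - \<delta>) * (\<Sum>i\<in>I. d I i * (x i)\<^sup>2)"
    by (rule spectral_gap[where K = K, OF I sym nn hub[unfolded d_def]]) (auto simp: d_def)
  \<comment> \<open>The closed form of iterating c to c / (2 - c) from \<open>1 - \<delta>\<close>:
    the ratio c / (1 - c) is halved at each step.\<close>
  define c where "c = (\<lambda>k::nat. (1 - \<delta>) / (1 - \<delta> + 2 ^ k * \<delta>))"
  have p: "1 - \<delta> + 2 ^ k * \<delta> > 0" for k :: nat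
    using \<delta> by (simp add: add_nonneg_pos)
  have c: "0 \<le> c k" "c k < 1" for k
    using \<delta> p[of k] by (simp_all add: c_def pos_divide_less_eq)
  have cS: "c (Suc k) = c k / (2 - c k)" for k
  proof -
    have "2 - c k = (1 - \<delta> + 2 ^ Suc k * \<delta>) / (1 - \<delta> + 2 ^ k * \<delta>)"
      using p[of k] by (simp add: c_def field_simps)
    then show ?thesis using p[of k] by (simp add: c_def)
  qed
  have bound: "(\<Sum>i\<in>I. d I i * x i) = 0 \<Longrightarrow> bilin I K x x \<le> c k * (\<Sum>i\<in>I. d I i * (x i)\<^sup>2)" for x k
  proof (induction k arbitrary: x)
    case 0
    then show ?case using gap by (simp add: c_def)
  next
    case (Suc k)
    show ?case unfolding cS
      using contraction_step[where K = K, OF I(1) sym nn, of "c k" x] sq c[of k] Suc unfolding d_def by blast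
  qed
  have "c \<longlonglongrightarrow> 0"
  proof -
    have "c k \<le> inverse (2 ^ k) * (1 / \<delta>)" for k
    proof -
      have "c k \<le> 1 / (2 ^ k * \<delta>)"
        unfolding c_def using \<delta> by (intro frac_le) auto
      then show ?thesis by (simp add: field_simps)
    qed
    moreover have "(\<lambda>k::nat. inverse (2 ^ k) * (1 / \<delta>)) \<longlonglongrightarrow> 0 * (1 / \<delta>)"
      by (intro tendsto_mult tendsto_const LIMSEQ_inverse_realpow_zero) simp
    ultimately show ?thesis using c(1)
      by (intro tendsto_sandwich[OF _ _ tendsto_const, of 0 c]) auto
  qed
  then have "(\<lambda>k. c k * (\<Sum>i\<in>I. d I i * (x i)\<^sup>2)) \<longlonglongrightarrow> 0 * (\<Sum>i\<in>I. d I i * (x i)\<^sup>2)"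
    by (intro tendsto_mult tendsto_const)
  then show ?thesis using bound[OF x]
    by (intro tendsto_lowerbound[where f = "\<lambda>k. c k * (\<Sum>i\<in>I. d I i * (x i)\<^sup>2)" and F = sequentially]) auto
qed

text \<open>In use, \<open>L k\<close> is w_k times the matrix of the derivative by k, and
  \<open>dec\<close> and \<open>row\<close> are Euler's relation. The hypothesis on
  \<open>L k\<close> then reads L_k(x,x) d_k \<le> (K x)_k^2; dividing by d_k and summing over k
  gives P \<le> P^2.\<close>

lemma reverse_cauchy_sum:
  fixes K :: "'a \<Rightarrow> 'a \<Rightarrow> real"
  assumes I: "finite I" "z \<in> I" and sym: "\<And>i j. K i j = K j i"
    and nn: "\<And>i j. i \<in> I \<Longrightarrow> j \<in> I \<Longrightarrow> K i j \<ge> 0"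
    and hub: "\<And>i. i \<in> I \<Longrightarrow> (\<Sum>j\<in>I. K i j) > 0 \<Longrightarrow> K z i > 0"
    and dec: "\<And>i j. i \<in> I \<Longrightarrow> j \<in> I \<Longrightarrow> K i j = (\<Sum>k\<in>I. L k i j)"
    and row: "\<And>k i. k \<in> I \<Longrightarrow> i \<in> I \<Longrightarrow> (\<Sum>j\<in>I. L k i j) = K k i"
    and nnL: "\<And>k i j. k \<in> I \<Longrightarrow> i \<in> I \<Longrightarrow> j \<in> I \<Longrightarrow> L k i j \<ge> 0"
    and rc: "\<And>k. k \<in> I \<Longrightarrow> reverse_cauchy I (L k)"
  shows "reverse_cauchy I K"
proof -
  define d where "d = (\<lambda>i. \<Sum>j\<in>I. K i j)"
  have d0: "d i \<ge> 0" if "i \<in> I" for i unfolding d_def using that nn by (simp add: sum_nonneg)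
  have L1: "bilin I (L k) (\<lambda>_. 1) (\<lambda>_. 1) = d k" if "k \<in> I" for k
    unfolding bilin_def d_def using row[OF that] by simp
  have Lx: "bilin I (L k) x (\<lambda>_. 1) = (\<Sum>j\<in>I. K k j * x j)" if "k \<in> I" for k x
    unfolding bilin_def using row[OF that] by (simp add: sum_distrib_right[symmetric])
  have Kx: "bilin I K x y = (\<Sum>k\<in>I. bilin I (L k) x y)" for x y
  proof -
    have "bilin I K x y = (\<Sum>i\<in>I. \<Sum>j\<in>I. \<Sum>k\<in>I. L k i j * x i * y j)"
      unfolding bilin_def by (intro sum.cong refl) (simp add: dec sum_distrib_right)
    also have "\<dots> = (\<Sum>i\<in>I. \<Sum>k\<in>I. \<Sum>j\<in>I. L k i j * x i * y j)"
      by (rule sum.cong[OF refl], rule sum.swap)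
    also have "\<dots> = (\<Sum>k\<in>I. bilin I (L k) x y)"
      unfolding bilin_def by (rule sum.swap)
    finally show ?thesis .
  qed
  have sq: "bilin I K x x \<le> (\<Sum>i\<in>I. (\<Sum>j\<in>I. K i j * x j)\<^sup>2 / d i)" for x
    unfolding Kx
  proof (rule sum_mono)
    fix k assume k: "k \<in> I"
    have *: "bilin I (L k) x x * d k \<le> (\<Sum>j\<in>I. K k j * x j)\<^sup>2"
      using rc[OF k] L1[OF k] Lx[OF k] unfolding reverse_cauchy_def by metis
    \<comment> \<open>If \<open>d k = 0\<close>, nonnegativity kills row \<open>k\<close> of
      \<open>K\<close> and hence all of \<open>L k\<close>, while the quotient is 0 by
      convention.\<close>
    show "bilin I (L k) x x \<le> (\<Sum>j\<in>I. K k j * x j)\<^sup>2 / d k"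
    proof (cases "d k = 0")
      case True
      then have "K k i = 0" if "i \<in> I" for i
        using nn k that I unfolding d_def by (simp add: sum_nonneg_eq_0_iff)
      then have "L k i j = 0" if "i \<in> I" "j \<in> I" for i j
        using row[OF k, of i] nnL k I that by (simp add: sum_nonneg_eq_0_iff)
      then show ?thesis using True by (simp add: bilin_def)
    next
      case False
      then show ?thesis using * d0[OF k] by (simp add: field_simps)
    qed
  qed
  have neg: "bilin I K x x \<le> 0" if "(\<Sum>i\<in>I. d i * x i) = 0" for x
    using negative_on_complement[where K = K, OF I sym nn hub] sq that unfolding d_def by blast
  have x1: "bilin I K x (\<lambda>_. 1) = (\<Sum>i\<in>I. d i * x i)" for x
    unfolding bilin_def d_def by (simp add: sum_distrib_right)
  have "bilin I K x x * bilin I K (\<lambda>_. 1) (\<lambda>_. 1) \<le> (bilin I K x (\<lambda>_. 1))\<^sup>2" for x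
  proof -
    let ?D = "bilin I K (\<lambda>_. 1) (\<lambda>_. 1)"
    have D: "?D = (\<Sum>i\<in>I. d i)" using x1[of "\<lambda>_. 1"] by simp
    have D0: "?D \<ge> 0" unfolding D using d0 by (simp add: sum_nonneg)
    show ?thesis
    proof (cases "?D = 0")
      case False
      \<comment> \<open>The shift by \<open>t\<close> removes the mean of \<open>x\<close>, so that
        \<open>neg\<close> applies.\<close>
      define t where "t = - (bilin I K x (\<lambda>_. 1) / ?D)"
      have "bilin I K (\<lambda>i. x i + t * 1) (\<lambda>_. 1) = 0"
        unfolding bilin_combine_left using False by (simp add: t_def)
      then have "bilin I K (\<lambda>i. x i + t * 1) (\<lambda>i. x i + t * 1) \<le> 0"
        using neg[of "\<lambda>i. x i + t * 1"] unfolding x1 by blast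
      then have "bilin I K x x + 2 * t * bilin I K x (\<lambda>_. 1) + t\<^sup>2 * ?D \<le> 0"
        unfolding bilin_square_combine[where K = K, OF sym] .
      moreover have "2 * t * bilin I K x (\<lambda>_. 1) + t\<^sup>2 * ?D = - (bilin I K x (\<lambda>_. 1))\<^sup>2 / ?D"
        using False by (simp add: t_def field_simps power2_eq_square)
      ultimately have "bilin I K x x \<le> (bilin I K x (\<lambda>_. 1))\<^sup>2 / ?D" by simp
      then show ?thesis using False D0 by (simp add: field_simps)
    qed simp
  qed
  then show ?thesis unfolding reverse_cauchy_def by blast
qed

section \<open>Rank and parallel classes\<close>

context matroid
begin

section \<open>Basic properties of the rank function\<close>

lemma finite_subset_ground: "A \<subseteq> E \<Longrightarrow> finite A"
  using finite_ground finite_subset by blast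

lemma finite_rank_candidates: "finite A \<Longrightarrow> finite {card X | X. X \<subseteq> A \<and> indep X}"
  by (rule finite_subset[of _ "card ` Pow A"]) auto

lemma card_le_matroid_rank:
  assumes "finite A" "X \<subseteq> A" "indep X"
  shows "card X \<le> matroid_rank indep A"
  unfolding matroid_rank_def using assms
  by (intro Max_ge finite_rank_candidates) auto

lemma matroid_rank_witness:
  assumes "finite A"
  obtains X where "X \<subseteq> A" "indep X" "card X = matroid_rank indep A"
proof -
  have "{card X | X. X \<subseteq> A \<and> indep X} \<noteq> {}" using indep_empty by blast
  then have "matroid_rank indep A \<in> {card X | X. X \<subseteq> A \<and> indep X}"
    unfolding matroid_rank_def using assms by (intro Max_in finite_rank_candidates)
  then show thesis using that by auto
qed

lemma matroid_rank_mono: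
  assumes "finite B" "A \<subseteq> B"
  shows "matroid_rank indep A \<le> matroid_rank indep B"
proof -
  obtain X where "X \<subseteq> A" "indep X" "card X = matroid_rank indep A"
    using matroid_rank_witness assms finite_subset by metis
  then show ?thesis using card_le_matroid_rank[OF assms(1), of X] assms(2) by auto
qed

lemma matroid_rank_insert_le:
  assumes "finite A"
  shows "matroid_rank indep (insert x A) \<le> Suc (matroid_rank indep A)"
proof -
  obtain X where X: "X \<subseteq> insert x A" "indep X" "card X = matroid_rank indep (insert x A)"
    using matroid_rank_witness assms finite.insertI by metis
  have "card (X - {x}) \<le> matroid_rank indep A"
    using X assms by (intro card_le_matroid_rank indep_subset[OF X(2)]) auto
  moreover have "card X \<le> Suc (card (X - {x}))"
    by (simp add: card_Diff_singleton_if, arith)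
  ultimately show ?thesis using X(3) by simp
qed

lemma indep_extend_to_basis:
  assumes "finite A" "B \<subseteq> A" "indep B"
  obtains C where "B \<subseteq> C" "C \<subseteq> A" "indep C" "card C = matroid_rank indep A"
proof -
  have "\<exists>C. B \<subseteq> C \<and> C \<subseteq> A \<and> indep C \<and> card C = matroid_rank indep A"
    using assms(2,3)
  proof (induction "matroid_rank indep A - card B" arbitrary: B)
    case 0
    then show ?case using card_le_matroid_rank[OF assms(1)] by (metis diff_is_0_eq le_antisym order_refl)
  next
    case (Suc k)
    obtain X where X: "X \<subseteq> A" "indep X" "card X = matroid_rank indep A"
      using matroid_rank_witness[OF assms(1)] .
    then have "card B < card X" using Suc.hyps(2) by linarith
    then obtain y where y: "y \<in> X - B" "indep (insert y B)"
      using indep_augment[of B X] X Suc.prems by blast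
    have "finite B" using Suc.prems assms(1) finite_subset by blast
    then have "k = matroid_rank indep A - card (insert y B)" using y Suc.hyps(2) by simp
    then show ?case using Suc.hyps(1)[of "insert y B"] y X Suc.prems by auto
  qed
  then show thesis using that by blast
qed

text \<open>If \<open>x\<close> raised the rank of \<open>A'\<close>, it would be the element that
  augments a basis of \<open>A'\<close> extending a basis \<open>B\<close> of \<open>A\<close>; then
  \<open>insert x B\<close> would be independent and \<open>x\<close> would raise the rank of
  \<open>A\<close> as well.\<close>

lemma matroid_rank_insert_superset:
  assumes "finite A'" "A \<subseteq> A'"
    and eq: "matroid_rank indep (insert x A) = matroid_rank indep A"
  shows "matroid_rank indep (insert x A') = matroid_rank indep A'"
proof (rule ccontr)
  assume ne: "matroid_rank indep (insert x A') \<noteq> matroid_rank indep A'"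
  have finA: "finite A" using assms finite_subset by blast
  obtain B where B: "B \<subseteq> A" "indep B" "card B = matroid_rank indep A"
    using matroid_rank_witness[OF finA] .
  obtain B' where B': "B \<subseteq> B'" "B' \<subseteq> A'" "indep B'" "card B' = matroid_rank indep A'"
    using indep_extend_to_basis[OF assms(1), of B] B assms(2) by auto
  have "matroid_rank indep A' < matroid_rank indep (insert x A')"
    using matroid_rank_mono[OF _ subset_insertI, of x A'] assms(1) ne by simp
  then obtain Y where Y: "Y \<subseteq> insert x A'" "indep Y" "card B' < card Y"
    using matroid_rank_witness[of "insert x A'"] assms(1) B'(4) by (metis finite_insert)
  then obtain y where y: "y \<in> Y - B'" "indep (insert y B')" using indep_augment B'(3) by blast
  have finB': "finite B'" using B' assms finite_subset by blast
  have "y \<notin> A'"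
  proof
    assume "y \<in> A'"
    then have "card (insert y B') \<le> matroid_rank indep A'"
      using B' y assms by (intro card_le_matroid_rank) auto
    then show False using y finB' B'(4) by simp
  qed
  then have yx: "y = x" using y Y by auto
  then have "x \<notin> B" using y B' by auto
  moreover have "finite B" using B finA finite_subset by blast
  moreover have "card (insert x B) \<le> matroid_rank indep (insert x A)"
    using B B' y yx finA by (intro card_le_matroid_rank indep_subset[OF y(2)]) auto
  ultimately show False using eq B by simp
qed

text \<open>Either \<open>i\<close> adds nothing to the rank of \<open>A\<close>, hence nothing over
  \<open>insert j A\<close>, or it adds one, which is the most it can add over
  \<open>insert j A\<close>.\<close>

lemma matroid_rank_local_submodular:
  assumes "finite A"
  shows "matroid_rank indep (insert i (insert j A)) + matroid_rank indep A
    \<le> matroid_rank indep (insert i A) + matroid_rank indep (insert j A)"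
proof (cases "matroid_rank indep (insert i A) = matroid_rank indep A")
  case True
  then show ?thesis using matroid_rank_insert_superset[OF _ subset_insertI, of j A i] assms by simp
next
  case False
  then have "matroid_rank indep (insert i A) \<ge> Suc (matroid_rank indep A)"
    using matroid_rank_mono[OF _ subset_insertI, of i A] assms False by simp
  then show ?thesis using matroid_rank_insert_le[of "insert j A" i] assms by auto
qed

text \<open>The parallel classes of the nonloops of the contraction by \<open>A\<close>;
  every loop is made a class of its own.\<close>

definition parallel_class :: "'a set \<Rightarrow> 'a \<Rightarrow> 'a set" where
  "parallel_class A i = {j. j = i \<or> (matroid_rank indep (insert i A) = Suc (matroid_rank indep A) \<and>
     matroid_rank indep (insert j A) = Suc (matroid_rank indep A) \<and>
     matroid_rank indep (insert i (insert j A)) = Suc (matroid_rank indep A))}"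

text \<open>Membership is an equivalence relation. For transitivity, submodularity over
  \<open>insert j A\<close> keeps the rank at one above that of \<open>A\<close> when both
  \<open>i\<close> and \<open>k\<close> are added.\<close>

lemma parallel_class_eq_iff:
  assumes "finite A"
  shows "parallel_class A i = parallel_class A j \<longleftrightarrow> j \<in> parallel_class A i"
proof
  assume "parallel_class A i = parallel_class A j"
  then show "j \<in> parallel_class A i" by (simp add: parallel_class_def)
next
  let ?r = "matroid_rank indep"
  have sym: "i \<in> parallel_class A j" if "j \<in> parallel_class A i" for i j
    using that by (auto simp: parallel_class_def insert_commute)
  have trans: "k \<in> parallel_class A i" if j: "j \<in> parallel_class A i" and k: "k \<in> parallel_class A j" for i j k
  proof (cases "i = j \<or> j = k")
    case True
    then show ?thesis using j k by auto
  next
    case False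
    then have *: "?r (insert i A) = Suc (?r A)" "?r (insert j A) = Suc (?r A)" "?r (insert k A) = Suc (?r A)"
      "?r (insert i (insert j A)) = Suc (?r A)" "?r (insert k (insert j A)) = Suc (?r A)"
      using j k by (auto simp: parallel_class_def insert_commute)
    have "?r (insert i (insert k (insert j A))) \<le> Suc (?r A)"
      using matroid_rank_local_submodular[of "insert j A" i k] assms * by simp
    moreover have "?r (insert i (insert k A)) \<le> ?r (insert i (insert k (insert j A)))"
      "?r (insert k A) \<le> ?r (insert i (insert k A))"
      using assms by (auto intro!: matroid_rank_mono)
    ultimately show ?thesis using * by (simp add: parallel_class_def)
  qed
  assume "j \<in> parallel_class A i"
  then show "parallel_class A i = parallel_class A j" using sym trans by blast
qed

text \<open>Submodularity with its exact defect, which becomes the exponent of \<open>q\<close> in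
  the Hessian entry of a pair. A loop causes no defect, which is why it is alone in its
  class.\<close>

lemma matroid_rank_insert_insert:
  assumes "finite A" "i \<noteq> j"
  shows "matroid_rank indep (insert i (insert j A)) + matroid_rank indep A
      + (if parallel_class A i = parallel_class A j then 1 else 0)
    = matroid_rank indep (insert i A) + matroid_rank indep (insert j A)"
proof -
  let ?r = "matroid_rank indep"
  have "?r A \<le> ?r (insert i A)" "?r A \<le> ?r (insert j A)"
    "?r (insert i A) \<le> ?r (insert i (insert j A))" "?r (insert j A) \<le> ?r (insert i (insert j A))"
    using assms by (auto intro!: matroid_rank_mono)
  then show ?thesis
    using matroid_rank_local_submodular[OF assms(1), of i j]
      matroid_rank_insert_le[OF assms(1), of i] matroid_rank_insert_le[OF assms(1), of j] assms(2)
    unfolding parallel_class_eq_iff[OF assms(1)] by (auto simp: parallel_class_def)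
qed

end

section \<open>The local-to-global principle\<close>

text \<open>The double sum is the sum of the squared fibre sums of \<open>u\<close>, so this is
  Cauchy-Schwarz over the fibres, of which there are at most \<open>card F\<close>.\<close>

lemma square_sum_le_card_mult_fibre_sum:
  fixes u :: "'a \<Rightarrow> real" and f :: "'a \<Rightarrow> 'b"
  assumes "finite F"
  shows "(\<Sum>i\<in>F. u i)\<^sup>2 \<le> card F * (\<Sum>i\<in>F. \<Sum>j\<in>F. if f i = f j then u i * u j else 0)"
proof -
  define s where "s = (\<lambda>c. \<Sum>i\<in>{i \<in> F. f i = c}. u i)"
  have "(\<Sum>j\<in>F. if f i = f j then u i * u j else 0) = u i * s (f i)" for i
    unfolding s_def sum_distrib_left using assms
    by (simp add: sum.inter_filter eq_commute[of "f i"])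
  then have "(\<Sum>i\<in>F. \<Sum>j\<in>F. if f i = f j then u i * u j else 0) = (\<Sum>i\<in>F. u i * s (f i))"
    by simp
  also have "\<dots> = (\<Sum>c\<in>f ` F. \<Sum>i\<in>{i \<in> F. f i = c}. u i * s (f i))"
    by (rule sum.group[OF assms finite_imageI[OF assms] order_refl, symmetric])
  also have "\<dots> = (\<Sum>c\<in>f ` F. (s c)\<^sup>2)"
    by (intro sum.cong refl) (simp add: s_def power2_eq_square sum_distrib_right)
  finally have *: "(\<Sum>i\<in>F. \<Sum>j\<in>F. if f i = f j then u i * u j else 0) = (\<Sum>c\<in>f ` F. (s c)\<^sup>2)" .
  have "(\<Sum>i\<in>F. u i) = (\<Sum>c\<in>f ` F. s c)"
    unfolding s_def by (rule sum.group[OF assms finite_imageI[OF assms] order_refl, symmetric])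
  then have "(\<Sum>i\<in>F. u i)\<^sup>2 \<le> (\<Sum>c\<in>f ` F. (s c)\<^sup>2) * card (f ` F)"
    using sum_squared_le_sum_of_squares by metis
  also have "\<dots> \<le> (\<Sum>c\<in>f ` F. (s c)\<^sup>2) * card F"
    using card_image_le[OF assms, of f] by (intro mult_left_mono) (auto intro: sum_nonneg)
  finally show ?thesis using * by (simp add: mult.commute)
qed

text \<open>The matrix is all ones minus \<open>q\<close> times the identity minus
  \<open>1 - q\<close> times the indicator of a common fibre. Cauchy-Schwarz bounds both subtracted
  forms, and the two bounds are averaged with weights \<open>q\<close> and \<open>1 - q\<close>;
  this is where \<open>q \<le> 1\<close> enters.\<close>

lemma sum_off_diagonal_le:
  fixes u :: "'a \<Rightarrow> real" and f :: "'a \<Rightarrow> 'b" and q :: real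
  assumes F: "finite F" and q: "0 \<le> q" "q \<le> 1"
  shows "card F * (\<Sum>i\<in>F. \<Sum>j\<in>F. (if i = j then 0 else if f i = f j then q else 1) * u i * u j)
    \<le> (real (card F) - 1) * (\<Sum>i\<in>F. u i)\<^sup>2"
proof -
  let ?S = "(\<Sum>i\<in>F. u i)\<^sup>2"
  let ?P = "\<Sum>i\<in>F. \<Sum>j\<in>F. if f i = f j then u i * u j else 0"
  have "(\<Sum>i\<in>F. \<Sum>j\<in>F. (if i = j then 0 else if f i = f j then q else 1) * u i * u j)
    = (\<Sum>i\<in>F. \<Sum>j\<in>F. u i * u j) - q * (\<Sum>i\<in>F. \<Sum>j\<in>F. if i = j then u i * u j else 0) - (1 - q) * ?P"
    unfolding sum_distrib_left sum_subtractf[symmetric]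
    by (intro sum.cong refl) (simp add: algebra_simps)
  also have "(\<Sum>i\<in>F. \<Sum>j\<in>F. u i * u j) = ?S"
    by (simp add: power2_eq_square sum_product)
  also have "(\<Sum>i\<in>F. \<Sum>j\<in>F. if i = j then u i * u j else 0) = (\<Sum>i\<in>F. (u i)\<^sup>2)"
    using F by (simp add: power2_eq_square)
  finally have T: "(\<Sum>i\<in>F. \<Sum>j\<in>F. (if i = j then 0 else if f i = f j then q else 1) * u i * u j)
    = ?S - q * (\<Sum>i\<in>F. (u i)\<^sup>2) - (1 - q) * ?P" .
  have "q * ?S \<le> q * (card F * (\<Sum>i\<in>F. (u i)\<^sup>2))"
    using sum_squared_le_sum_of_squares[of u F] q by (intro mult_left_mono) (auto simp: mult.commute)
  moreover have "(1 - q) * ?S \<le> (1 - q) * (card F * ?P)"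
    using square_sum_le_card_mult_fibre_sum[OF F, of u f] q by (intro mult_left_mono) auto
  ultimately show ?thesis unfolding T by (simp add: algebra_simps)
qed

section \<open>The Hessian in degree two\<close>

lemma bilin_insert:
  assumes "finite F" "z \<notin> F"
  shows "bilin (insert z F) M x y = M z z * x z * y z + (\<Sum>j\<in>F. M z j * x z * y j)
    + (\<Sum>i\<in>F. M i z * x i * y z) + bilin F M x y"
  unfolding bilin_def using assms by (simp add: sum.distrib)

text \<open>Up to scaling by \<open>s\<close> and \<open>C\<close> the matrix is \<open>M\<close>.
  In the direction of the unit vector at \<open>z\<close> the inequality for \<open>M\<close>
  reduces to \<open>sum_off_diagonal_le\<close>; from there it is transferred to the direction
  \<open>s\<close>.\<close>

lemma reverse_cauchy_star:
  fixes s :: "'a \<Rightarrow> real" and f :: "'a \<Rightarrow> 'b" and q :: real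
  assumes F: "finite F" "z \<notin> F" "card F = c + 2" and q: "0 \<le> q" "q \<le> 1"
    and C: "C \<ge> 0" and s: "s z > 0" "\<And>i. i \<in> F \<Longrightarrow> s i \<ge> 0"
    and Kzz: "K z z = C * (real c + 2) * (real c + 1) * s z * s z"
    and Kzi: "\<And>i. i \<in> F \<Longrightarrow> K z i = C * (real c + 1) * s z * s i"
    and Kiz: "\<And>i. i \<in> F \<Longrightarrow> K i z = C * (real c + 1) * s i * s z"
    and Kij: "\<And>i j. i \<in> F \<Longrightarrow> j \<in> F \<Longrightarrow>
      K i j = C * (if i = j then 0 else if f i = f j then q else 1) * s i * s j"
  shows "reverse_cauchy (insert z F) K"
proof -
  define M where "M = (\<lambda>i j. if i = z \<and> j = z then (real c + 2) * (real c + 1)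
    else if i = z \<or> j = z then real c + 1 else if i = j then 0 else if f i = f j then q else 1)"
  let ?J = "insert z F"
  have symM: "M i j = M j i" for i j by (auto simp: M_def)
  have KM: "K i j = C * M i j * s i * s j" if "i \<in> ?J" "j \<in> ?J" for i j
    using that F(2) Kzz Kzi Kiz Kij by (auto simp: M_def)
  have bK: "bilin ?J K x y = C * bilin ?J M (\<lambda>i. s i * x i) (\<lambda>i. s i * y i)" for x y
    unfolding bilin_def sum_distrib_left by (intro sum.cong refl) (simp add: KM mult_ac)
  define e where "e = (\<lambda>i. if i = z then 1 else 0 :: real)"
  have nz: "i \<noteq> z" if "i \<in> F" for i using that F by auto
  have bM: "bilin ?J M x y = (real c + 2) * (real c + 1) * x z * y z
      + (real c + 1) * x z * (\<Sum>j\<in>F. y j) + (real c + 1) * y z * (\<Sum>j\<in>F. x j)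
      + (\<Sum>i\<in>F. \<Sum>j\<in>F. (if i = j then 0 else if f i = f j then q else 1) * x i * y j)" for x y
  proof -
    have "M z z = (real c + 2) * (real c + 1)" by (simp add: M_def)
    moreover have "(\<Sum>j\<in>F. M z j * x z * y j) = (real c + 1) * x z * (\<Sum>j\<in>F. y j)"
      unfolding sum_distrib_left using nz by (intro sum.cong refl) (auto simp: M_def)
    moreover have "(\<Sum>j\<in>F. M j z * x j * y z) = (real c + 1) * y z * (\<Sum>j\<in>F. x j)"
      unfolding sum_distrib_left using nz by (intro sum.cong refl) (auto simp: M_def)
    moreover have "bilin F M x y
        = (\<Sum>i\<in>F. \<Sum>j\<in>F. (if i = j then 0 else if f i = f j then q else 1) * x i * y j)"
      unfolding bilin_def using nz by (intro sum.cong refl) (auto simp: M_def)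
    ultimately show ?thesis unfolding bilin_insert[OF F(1,2)] by simp
  qed
  have e0: "e z = 1" "(\<Sum>j\<in>F. e j) = 0" "\<And>i. i \<in> F \<Longrightarrow> e i = 0"
    using nz by (auto simp: e_def)
  have bee: "bilin ?J M e e = (real c + 2) * (real c + 1)"
    unfolding bM e0 by (simp add: e0(3))
  have bex: "bilin ?J M e x = (real c + 2) * (real c + 1) * x z + (real c + 1) * (\<Sum>j\<in>F. x j)" for x
    unfolding bM e0 by (simp add: e0(3))
  have neg: "bilin ?J M e e * bilin ?J M x x \<le> (bilin ?J M e x)\<^sup>2" for x
  proof -
    let ?T = "\<Sum>i\<in>F. \<Sum>j\<in>F. (if i = j then 0 else if f i = f j then q else 1) * x i * x j"
    have "(real c + 2) * ?T \<le> (real c + 1) * (\<Sum>j\<in>F. x j)\<^sup>2"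
      using sum_off_diagonal_le[OF F(1) q, of f x] F(3) by (simp add: add_ac)
    then have "(real c + 1) * ((real c + 2) * ?T) \<le> (real c + 1) * ((real c + 1) * (\<Sum>j\<in>F. x j)\<^sup>2)"
      by (intro mult_left_mono) auto
    \<comment> \<open>All terms containing \<open>a\<close> cancel, and the assumption on
      \<open>S\<close> and \<open>T\<close> is what remains.\<close>
    moreover have "(real c + 2) * (real c + 1) * ((real c + 2) * (real c + 1) * a * a
          + (real c + 1) * a * S + (real c + 1) * a * S + T)
        \<le> ((real c + 2) * (real c + 1) * a + (real c + 1) * S)\<^sup>2"
      if "(real c + 1) * ((real c + 2) * T) \<le> (real c + 1) * ((real c + 1) * S\<^sup>2)" for a S T
      using that by (simp add: power2_eq_square algebra_simps)
    ultimately show ?thesis unfolding bee unfolding bex bM[of x x] by blast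
  qed
  \<comment> \<open>The factor 1 keeps the form in which \<open>bK\<close> produces the scaled
    all-ones vector.\<close>
  define u where "u = (\<lambda>i. s i * 1)"
  have u: "bilin ?J M e u > 0" "bilin ?J M u u \<ge> 0"
  proof -
    have u0: "u i \<ge> 0" if "i \<in> F" for i using s that by (auto simp: u_def)
    have "(real c + 2) * (real c + 1) * u z > 0" "(real c + 1) * (\<Sum>j\<in>F. u j) \<ge> 0"
      using s(1) u0 by (auto simp: u_def sum_nonneg)
    then show "bilin ?J M e u > 0" unfolding bex by simp
    show "bilin ?J M u u \<ge> 0" unfolding bilin_def using s q
      by (intro sum_nonneg mult_nonneg_nonneg) (auto simp: M_def u_def)
  qed
  have main: "bilin ?J M x x * bilin ?J M u u \<le> (bilin ?J M x u)\<^sup>2" for x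
    using reverse_cauchy_from_direction[where K = M, OF symM neg _ u] bee by simp
  show ?thesis
    unfolding reverse_cauchy_def
  proof
    fix x
    have "C\<^sup>2 * (bilin ?J M (\<lambda>i. s i * x i) (\<lambda>i. s i * x i) * bilin ?J M u u)
        \<le> C\<^sup>2 * (bilin ?J M (\<lambda>i. s i * x i) u)\<^sup>2"
      using main by (intro mult_left_mono) auto
    then show "bilin ?J K x x * bilin ?J K (\<lambda>_. 1) (\<lambda>_. 1) \<le> (bilin ?J K x (\<lambda>_. 1))\<^sup>2"
      unfolding bK u_def[symmetric] by (simp add: power2_eq_square algebra_simps)
  qed
qed

text \<open>Serves to drop variables of \<open>E\<close> that were already differentiated: the
  polynomial is affine in each of them, so their rows and columns vanish.\<close>

lemma reverse_cauchy_superset: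
  assumes "reverse_cauchy J K" "finite I" "J \<subseteq> I"
    and zero: "\<And>i j. i \<in> I \<Longrightarrow> j \<in> I \<Longrightarrow> i \<notin> J \<or> j \<notin> J \<Longrightarrow> K i j = 0"
  shows "reverse_cauchy I K"
proof -
  have "bilin I K x y = bilin J K x y" for x y
  proof -
    have "bilin I K x y = (\<Sum>i\<in>J. \<Sum>j\<in>I. K i j * x i * y j)"
      unfolding bilin_def using assms by (intro sum.mono_neutral_right) (auto simp: zero intro!: sum.neutral)
    also have "\<dots> = bilin J K x y"
      unfolding bilin_def using assms by (intro sum.cong refl sum.mono_neutral_right) (auto simp: zero)
    finally show ?thesis .
  qed
  then show ?thesis using assms(1) by (simp add: reverse_cauchy_def)
qed

text \<open>If f is homogeneous of degree \<open>size X + r\<close> and its derivatives of top order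
  are the values of \<open>g\<close>, this is r! times the derivative of f along \<open>X\<close>,
  evaluated at \<open>w\<close>. Multisets reflect that the order of differentiation is
  irrelevant.\<close>

primrec iterated_sum ::
    "'a set \<Rightarrow> ('a \<Rightarrow> real) \<Rightarrow> ('a multiset \<Rightarrow> real) \<Rightarrow> nat \<Rightarrow> 'a multiset \<Rightarrow> real" where
  "iterated_sum I w g 0 X = g X"
| "iterated_sum I w g (Suc r) X = (\<Sum>k\<in>I. w k * iterated_sum I w g r (add_mset k X))"

lemma iterated_sum_nonneg:
  assumes "\<And>X. g X \<ge> 0" "\<And>i. i \<in> I \<Longrightarrow> w i \<ge> 0"
  shows "iterated_sum I w g r X \<ge> 0"
  using assms by (induction r arbitrary: X) (auto intro!: sum_nonneg)

text \<open>A positive sum has a positive summand, in which \<open>k\<close> is exchanged for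
  \<open>z\<close> by induction. This provides, in every degree, the positivity that
  \<open>reverse_cauchy_sum\<close> demands of row \<open>z\<close>.\<close>

lemma iterated_sum_hub:
  assumes "finite I" and g: "\<And>X. g X \<ge> 0" and w: "\<And>i. i \<in> I \<Longrightarrow> w i > 0"
    and hub: "\<And>k X. g (add_mset k X) > 0 \<Longrightarrow> g (add_mset z X) > 0"
    and "iterated_sum I w g r (add_mset k X) > 0"
  shows "iterated_sum I w g r (add_mset z X) > 0"
  using assms(5)
proof (induction r arbitrary: X)
  case (Suc r)
  have nn: "iterated_sum I w g r X \<ge> 0" for X
    using iterated_sum_nonneg[of g I w] g w by (simp add: less_imp_le)
  obtain l where l: "l \<in> I" "w l * iterated_sum I w g r (add_mset l (add_mset k X)) > 0"
    using Suc.prems sum_nonpos[of I "\<lambda>l. w l * iterated_sum I w g r (add_mset l (add_mset k X))"]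
    by (fastforce simp: not_le)
  then have "iterated_sum I w g r (add_mset k (add_mset l X)) > 0"
    using w by (simp add: zero_less_mult_iff add_mset_commute) (metis less_asym)
  then have "iterated_sum I w g r (add_mset z (add_mset l X)) > 0"
    by (rule Suc.IH)
  then have "iterated_sum I w g r (add_mset l (add_mset z X)) > 0"
    by (subst add_mset_commute)
  then show ?case
    using l w nn assms(1) by (auto intro!: sum_pos2[of I l] simp: less_imp_le)
qed (use hub in auto)

text \<open>Induction on \<open>r\<close> from quadratic forms upwards: the matrices for
  \<open>add_mset k X\<close> one level down, weighted by \<open>w k\<close>, are the summands in
  \<open>reverse_cauchy_sum\<close>.\<close>

lemma reverse_cauchy_iterated_sum:
  assumes I: "finite I" "z \<in> I" and g: "\<And>X. g X \<ge> 0" and w: "\<And>i. i \<in> I \<Longrightarrow> w i > 0"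
    and hub: "\<And>k X. g (add_mset k X) > 0 \<Longrightarrow> g (add_mset z X) > 0"
    and base: "\<And>X. set_mset X \<subseteq> I \<Longrightarrow> size X = d \<Longrightarrow>
      reverse_cauchy I (\<lambda>i j. w i * w j * g (add_mset i (add_mset j X)))"
    and X: "set_mset X \<subseteq> I" "size X + r = d"
  shows "reverse_cauchy I (\<lambda>i j. w i * w j * iterated_sum I w g r (add_mset i (add_mset j X)))"
  using X
proof (induction r arbitrary: X)
  case 0
  then show ?case using base by simp
next
  case (Suc r)
  define G where "G = iterated_sum I w g"
  have nn: "G r X \<ge> 0" for r X
    unfolding G_def using iterated_sum_nonneg[of g I w] g w by (simp add: less_imp_le)
  have w0: "w i \<ge> 0" if "i \<in> I" for i using w[OF that] by simp
  let ?L = "\<lambda>k i j. w k * (w i * w j * G r (add_mset i (add_mset j (add_mset k X))))"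
  let ?K = "\<lambda>i j. w i * w j * G (Suc r) (add_mset i (add_mset j X))"
  have "reverse_cauchy I ?K"
  proof (rule reverse_cauchy_sum[OF I, where L = ?L])
    show "?K i j = ?K j i" for i j by (simp add: add_mset_commute mult.commute)
    show "?K i j \<ge> 0" if "i \<in> I" "j \<in> I" for i j
      using w0 that nn by simp
    show "?L k i j \<ge> 0" if "k \<in> I" "i \<in> I" "j \<in> I" for k i j
      using w0 that nn by simp
    show "?K i j = (\<Sum>k\<in>I. ?L k i j)" for i j
    proof -
      have *: "add_mset k (add_mset i (add_mset j X)) = add_mset i (add_mset j (add_mset k X))" for k
        by (simp add: add_mset_commute)
      show ?thesis by (simp add: G_def sum_distrib_left mult_ac *)
    qed
    show "(\<Sum>j\<in>I. ?L k i j) = ?K k i" for k i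
    proof -
      have *: "add_mset j (add_mset k (add_mset i X)) = add_mset i (add_mset j (add_mset k X))" for j
        by (simp add: add_mset_commute)
      show ?thesis by (simp add: G_def sum_distrib_left mult_ac *)
    qed
    show "?K z i > 0" if i: "i \<in> I" and pos: "(\<Sum>j\<in>I. ?K i j) > 0" for i
    proof -
      obtain j where j: "j \<in> I" "?K i j > 0"
        using pos sum_nonpos[of I "?K i"] by (fastforce simp: not_le)
      then have "G (Suc r) (add_mset i (add_mset j X)) > 0"
        using zero_less_mult_pos mult_pos_pos[OF w[OF i] w[OF j(1)]] by blast
      then have "G (Suc r) (add_mset j (add_mset i X)) > 0"
        by (subst add_mset_commute)
      then have "G (Suc r) (add_mset z (add_mset i X)) > 0"
        unfolding G_def by (rule iterated_sum_hub[where z = z, rotated -1]) (fact I g w hub)+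
      then show ?thesis using w[OF i] w[OF I(2)] by simp
    qed
    show "reverse_cauchy I (?L k)" if k: "k \<in> I" for k
    proof -
      have "reverse_cauchy I (\<lambda>i j. w i * w j * G r (add_mset i (add_mset j (add_mset k X))))"
        unfolding G_def using Suc.prems k by (intro Suc.IH) auto
      \<comment> \<open>The weight \<open>w k\<close> multiplies both sides of the inequality by its
        square.\<close>
      moreover have "bilin I (\<lambda>i j. c * M i j) x y = c * bilin I M x y" for c M x y
        unfolding bilin_def sum_distrib_left by (simp add: mult_ac)
      moreover have "c * a * (c * b) \<le> (c * d)\<^sup>2" if "a * b \<le> d\<^sup>2" for a b c d :: real
        using mult_left_mono[OF that, of "c\<^sup>2"] by (simp add: power2_eq_square mult_ac)
      ultimately show ?thesis unfolding reverse_cauchy_def by simp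
    qed
  qed
  then show ?case by (simp add: G_def)
qed

section \<open>Limits and expansions of iterated sums\<close>

lemma tendsto_iterated_sum:
  assumes "\<And>i. i \<in> I \<Longrightarrow> ((\<lambda>t. W t i) \<longlongrightarrow> w i) F"
  shows "((\<lambda>t. iterated_sum I (W t) g r X) \<longlongrightarrow> iterated_sum I w g r X) F"
  using assms by (induction r arbitrary: X) (auto intro!: tendsto_sum tendsto_mult)

text \<open>The iterated sum runs over sequences. Only those with distinct entries in
  \<open>E\<close> can contribute, and each set of size \<open>r\<close> is listed in r!
  orders.\<close>

lemma iterated_sum_eq_sum_subsets:
  assumes E: "finite E" "z \<notin> E" and wz: "w z = 0"
    and rep: "\<And>X e. e \<in> E \<Longrightarrow> count X e \<ge> 2 \<Longrightarrow> g X = 0"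
  shows "iterated_sum (insert z E) w g r X
    = fact r * (\<Sum>B | B \<subseteq> E \<and> card B = r. g (X + mset_set B) * (\<Prod>i\<in>B. w i))"
proof (induction r arbitrary: X)
  case 0
  have "{B. B \<subseteq> E \<and> card B = 0} = {{}}"
    using E by (auto simp: card_eq_0_iff dest: finite_subset)
  then show ?case by simp
next
  case (Suc r)
  define S where "S = (\<lambda>r. {B. B \<subseteq> E \<and> card B = r})"
  define h where "h = (\<lambda>B. g (X + mset_set B) * (\<Prod>i\<in>B. w i))"
  have finS: "finite (S r)" for r unfolding S_def using E by simp
  have finB: "finite B" if "B \<in> S r" for B r using that E finite_subset by (auto simp: S_def)
  have "iterated_sum (insert z E) w g (Suc r) X
      = (\<Sum>k\<in>E. w k * (fact r * (\<Sum>B\<in>S r. g (add_mset k X + mset_set B) * (\<Prod>i\<in>B. w i))))"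
    using E wz by (simp add: Suc.IH S_def)
  also have "\<dots> = fact r * (\<Sum>k\<in>E. \<Sum>B\<in>S r. w k * (g (add_mset k X + mset_set B) * (\<Prod>i\<in>B. w i)))"
    by (simp add: sum_distrib_left mult_ac)
  also have "(\<Sum>k\<in>E. \<Sum>B\<in>S r. w k * (g (add_mset k X + mset_set B) * (\<Prod>i\<in>B. w i)))
      = (\<Sum>k\<in>E. \<Sum>B\<in>{B \<in> S r. k \<notin> B}. h (insert k B))"
  proof (rule sum.cong[OF refl])
    fix k assume k: "k \<in> E"
    have "(\<Sum>B\<in>S r. w k * (g (add_mset k X + mset_set B) * (\<Prod>i\<in>B. w i)))
        = (\<Sum>B\<in>{B \<in> S r. k \<notin> B}. w k * (g (add_mset k X + mset_set B) * (\<Prod>i\<in>B. w i)))"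
    proof (rule sum.mono_neutral_right[OF finS])
      show "\<forall>B\<in>S r - {B \<in> S r. k \<notin> B}. w k * (g (add_mset k X + mset_set B) * (\<Prod>i\<in>B. w i)) = 0"
      proof
        fix B assume "B \<in> S r - {B \<in> S r. k \<notin> B}"
        then have "k \<in> B" "finite B" using finB by auto
        then have "g (add_mset k X + mset_set B) = 0" using k by (intro rep[of k]) auto
        then show "w k * (g (add_mset k X + mset_set B) * (\<Prod>i\<in>B. w i)) = 0" by simp
      qed
    qed auto
    also have "\<dots> = (\<Sum>B\<in>{B \<in> S r. k \<notin> B}. h (insert k B))"
      by (intro sum.cong refl) (auto simp: h_def finB)
    finally show "(\<Sum>B\<in>S r. w k * (g (add_mset k X + mset_set B) * (\<Prod>i\<in>B. w i)))
      = (\<Sum>B\<in>{B \<in> S r. k \<notin> B}. h (insert k B))" .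
  qed
  also have "\<dots> = (\<Sum>(k, B)\<in>Sigma E (\<lambda>k. {B \<in> S r. k \<notin> B}). h (insert k B))"
    using E finS by (subst sum.Sigma) auto
  \<comment> \<open>Adding \<open>k\<close> to \<open>B\<close> gives a set of size
    \<open>Suc r\<close> with a marked element, so every such set occurs \<open>Suc r\<close>
    times.\<close>
  also have "\<dots> = (\<Sum>(B, k)\<in>Sigma (S (Suc r)) (\<lambda>B. B). h B)"
  proof (rule sum.reindex_bij_witness[where j = "\<lambda>(k, B). (insert k B, k)" and i = "\<lambda>(B, k). (k, B - {k})"], goal_cases)
    case (2 p)
    then obtain k B where p: "p = (k, B)" "k \<in> E" "B \<in> S r" "k \<notin> B" by blast
    then show ?case using finB[OF p(3)] by (simp add: S_def)
  next
    case (4 p)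
    then obtain k B where p: "p = (B, k)" "B \<in> S (Suc r)" "k \<in> B" by blast
    then show ?case using finB[OF p(2)] by (auto simp: S_def)
  qed auto
  also have "\<dots> = (\<Sum>B\<in>S (Suc r). \<Sum>k\<in>B. h B)"
    using finS finB by (subst sum.Sigma) auto
  also have "\<dots> = (\<Sum>B\<in>S (Suc r). real (Suc r) * h B)"
    by (intro sum.cong refl) (simp add: S_def)
  finally show ?case by (simp add: S_def h_def sum_distrib_left mult_ac)
qed

section \<open>The Potts model\<close>

text \<open>The constant obtained by differentiating
  $\sum_A q^{-\mathrm{rk}(A)} w_z^{n - |A|} \prod_{i \in A} w_i$ once for each element of
  a multiset of size $n$.\<close>

definition potts_coeff :: "'a \<Rightarrow> ('a set \<Rightarrow> bool) \<Rightarrow> real \<Rightarrow> 'a multiset \<Rightarrow> real" where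
  "potts_coeff z indep q X = (if \<forall>e. e \<noteq> z \<longrightarrow> count X e \<le> 1
     then fact (count X z) * q powi (- int (matroid_rank indep (set_mset X - {z}))) else 0)"

lemma potts_coeff_nonneg: "q > 0 \<Longrightarrow> potts_coeff z indep q X \<ge> 0"
  by (simp add: potts_coeff_def)

text \<open>Replacing \<open>k\<close> by \<open>z\<close> creates no repetition outside
  \<open>z\<close>, and without such repetitions the coefficient is positive.\<close>

lemma potts_coeff_hub:
  assumes "q > 0" "potts_coeff z indep q (add_mset k X) > 0"
  shows "potts_coeff z indep q (add_mset z X) > 0"
proof -
  have sq: "\<forall>e. e \<noteq> z \<longrightarrow> count (add_mset k X) e \<le> 1"
  proof (rule ccontr)
    assume "\<not> (\<forall>e. e \<noteq> z \<longrightarrow> count (add_mset k X) e \<le> 1)"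
    then have "potts_coeff z indep q (add_mset k X) = 0"
      unfolding potts_coeff_def by (rule if_not_P)
    then show False using assms(2) by simp
  qed
  have "count (add_mset z X) e \<le> 1" if "e \<noteq> z" for e
  proof -
    have "count X e \<le> count (add_mset k X) e" by simp
    also have "\<dots> \<le> 1" using sq that by blast
    finally show ?thesis using that by simp
  qed
  then have "potts_coeff z indep q (add_mset z X) = fact (count (add_mset z X) z)
      * q powi (- int (matroid_rank indep (set_mset (add_mset z X) - {z})))"
    unfolding potts_coeff_def by (intro if_P) blast
  then show ?thesis using assms(1) by simp
qed

lemma potts_coeff_repeated: "z \<noteq> e \<Longrightarrow> count X e \<ge> 2 \<Longrightarrow> potts_coeff z indep q X = 0"
  unfolding potts_coeff_def by (rule if_not_P) (metis not_less_eq_eq one_add_one plus_1_eq_Suc)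

context matroid
begin

text \<open>Either \<open>X\<close> repeats an element of \<open>E\<close> and the matrix vanishes,
  or \<open>X\<close> consists of \<open>c\<close> copies of \<open>z\<close> and a set
  \<open>A\<close>. In the second case the exact submodularity defect brings the matrix on the
  remaining elements \<open>F\<close> into the shape of \<open>reverse_cauchy_star\<close>.\<close>

lemma reverse_cauchy_potts_base:
  assumes z: "z \<notin> E" and q: "0 < q" "q \<le> 1"
    and w: "\<And>i. i \<in> insert z E \<Longrightarrow> w i > 0"
    and X: "set_mset X \<subseteq> insert z E" "size X + 2 = card E"
  shows "reverse_cauchy (insert z E) (\<lambda>i j. w i * w j * potts_coeff z indep q (add_mset i (add_mset j X)))"
    (is "reverse_cauchy _ ?K")
proof (cases "\<forall>e. e \<noteq> z \<longrightarrow> count X e \<le> 1")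
  case False
  then obtain e where e: "e \<noteq> z" "count X e \<ge> 2" by (metis not_less_eq_eq one_add_one plus_1_eq_Suc)
  have "potts_coeff z indep q (add_mset i (add_mset j X)) = 0" for i j
  proof (rule potts_coeff_repeated)
    have "count X e \<le> count (add_mset i (add_mset j X)) e" by simp
    then show "2 \<le> count (add_mset i (add_mset j X)) e" using e(2) by linarith
  qed (use e(1) in simp)
  then show ?thesis by (simp add: reverse_cauchy_def bilin_def)
next
  case True
  define A where "A = set_mset X - {z}"
  define c where "c = count X z"
  define F where "F = E - A"
  have AE: "A \<subseteq> E" using X by (auto simp: A_def)
  have finA: "finite A" by (simp add: A_def)
  have countA: "count X e = (if e \<in> A then 1 else 0)" if "e \<noteq> z" for e
  proof -
    have "count X e \<le> 1" using True that by blast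
    then have "count X e = 0 \<or> count X e = 1" by linarith
    moreover have "e \<in> A \<longleftrightarrow> count X e > 0" using that by (simp add: A_def)
    ultimately show ?thesis by (metis less_irrefl zero_less_one)
  qed
  have "size X = c + card A"
  proof -
    have "X = replicate_mset c z + mset_set A"
      by (rule multiset_eqI) (use finA countA in \<open>auto simp: c_def A_def count_mset_set'\<close>)
    then show ?thesis by (metis size_union size_replicate_mset size_mset_set)
  qed
  \<comment> \<open>The two missing elements of \<open>X\<close> are what ties the number of copies
    of \<open>z\<close> to the size of \<open>F\<close>.\<close>
  then have cardF: "card F = c + 2"
    using X(2) AE finite_ground card_mono[OF finite_ground AE] by (simp add: F_def card_Diff_subset finA)
  let ?r = "matroid_rank indep"
  define a where "a = (\<lambda>B. q powi (- int (?r B)))"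
  have a0: "a B > 0" for B using q by (simp add: a_def)
  \<comment> \<open>The rank identity in exponential form: a defect of one contributes one factor
    \<open>q\<close>.\<close>
  have aa: "a (insert i (insert j A)) * a A
      = (if parallel_class A i = parallel_class A j then q else 1) * a (insert i A) * a (insert j A)"
    if "i \<noteq> j" for i j
  proof -
    define \<delta> where "\<delta> = (if parallel_class A i = parallel_class A j then 1 else 0 :: nat)"
    have "- int (?r (insert i (insert j A))) + - int (?r A)
        = int \<delta> + (- int (?r (insert i A)) + - int (?r (insert j A)))"
      using matroid_rank_insert_insert[OF finA that] by (simp add: \<delta>_def)
    moreover have "q powi (k + l) = q powi k * q powi l" for k l
      using q by (simp add: power_int_add)
    ultimately have "a (insert i (insert j A)) * a A = q powi int \<delta> * (a (insert i A) * a (insert j A))"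
      unfolding a_def by metis
    then show ?thesis by (simp add: \<delta>_def)
  qed
  have F: "z \<notin> F" "finite F" using z finite_ground by (auto simp: F_def)
  have nz: "i \<noteq> z" "i \<notin> A" if "i \<in> F" for i using that F by (auto simp: F_def)
  have pzz: "potts_coeff z indep q (add_mset z (add_mset z X)) = fact (c + 2) * a A"
    using True by (simp add: potts_coeff_def a_def A_def c_def)
  have val: "potts_coeff z indep q Y = fact (count Y z) * a (set_mset Y - {z})"
    if "\<And>e. e \<noteq> z \<Longrightarrow> count Y e \<le> 1" for Y
    unfolding a_def potts_coeff_def using that by (intro if_P) blast
  have pzi: "potts_coeff z indep q (add_mset z (add_mset i X)) = fact (c + 1) * a (insert i A)" if "i \<in> F" for i
  proof -
    have "insert i (set_mset X) - {z} = insert i A" using nz[OF that] by (auto simp: A_def)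
    moreover have "count (add_mset z (add_mset i X)) e \<le> 1" if "e \<noteq> z" for e
      using countA[OF that] that nz[OF \<open>i \<in> F\<close>] by auto
    ultimately show ?thesis using nz[OF that] by (subst val) (simp_all add: c_def)
  qed
  have pij: "potts_coeff z indep q (add_mset i (add_mset j X))
      = (if i = j then 0 else fact c * a (insert i (insert j A)))" if "i \<in> F" "j \<in> F" for i j
  proof (cases "i = j")
    case True
    then show ?thesis using nz[OF that(1)] by (simp add: potts_coeff_repeated[of z i])
  next
    case False
    have "insert i (insert j (set_mset X)) - {z} = insert i (insert j A)"
      using nz that by (auto simp: A_def)
    moreover have "count (add_mset i (add_mset j X)) e \<le> 1" if "e \<noteq> z" for e
      using countA[OF that] nz[OF \<open>i \<in> F\<close>] nz[OF \<open>j \<in> F\<close>] False by auto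
    ultimately show ?thesis using nz[OF that(1)] nz[OF that(2)] False
      by (subst val) (simp_all add: c_def)
  qed
  have pA: "potts_coeff z indep q (add_mset i (add_mset j X)) = 0" if "i \<in> A \<or> j \<in> A" for i j
  proof -
    obtain e where e: "e \<in> A" "e = i \<or> e = j" using \<open>i \<in> A \<or> j \<in> A\<close> by blast
    then have "e \<noteq> z" by (simp add: A_def)
    then show ?thesis using e countA[of e] by (intro potts_coeff_repeated[of z e]) auto
  qed
  \<comment> \<open>Absorbing \<open>a (insert i A) / a A\<close> into the weights leaves only 0,
    \<open>q\<close> and 1 as entries within \<open>F\<close>, up to the common factor
    \<open>fact c * a A\<close>.\<close>
  define s where "s = (\<lambda>i. if i = z then w z else w i * a (insert i A) / a A)"
  have s: "s z = w z" "\<And>i. i \<in> F \<Longrightarrow> s i = w i * a (insert i A) / a A"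
    using nz by (auto simp: s_def)
  have "reverse_cauchy (insert z F) ?K"
  proof (rule reverse_cauchy_star[OF F(2,1) cardF, of q "fact c * a A" s ?K "parallel_class A"])
    show "0 \<le> fact c * a A" using a0[of A] by simp
    show "0 < s z" using w by (simp add: s)
    show "0 \<le> s i" if "i \<in> F" for i
      using w[of i] a0 that by (simp add: s F_def less_imp_le)
    show "?K z z = fact c * a A * (real c + 2) * (real c + 1) * s z * s z"
      by (simp add: pzz s algebra_simps)
    show "?K z i = fact c * a A * (real c + 1) * s z * s i" if "i \<in> F" for i
      using a0[of A] by (simp add: pzi[OF that] s that field_simps)
    show "?K i z = fact c * a A * (real c + 1) * s i * s z" if "i \<in> F" for i
      using a0[of A] by (simp add: add_mset_commute[of i z] pzi[OF that] s that field_simps)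
    show "?K i j = fact c * a A * (if i = j then 0
        else if parallel_class A i = parallel_class A j then q else 1) * s i * s j"
      if ij: "i \<in> F" "j \<in> F" for i j
    proof (cases "i = j")
      case False
      have "?K i j = fact c * (w i * w j) * (a (insert i (insert j A)) * a A) / a A"
        using False a0[of A] by (simp add: pij[OF ij])
      then show ?thesis unfolding aa[OF False] s(2)[OF ij(1)] s(2)[OF ij(2)]
        using False a0[of A] by (simp add: field_simps)
    qed (use pij[OF ij] in simp)
  qed (use q in auto)
  then show ?thesis
    by (rule reverse_cauchy_superset) (use finite_ground pA F_def in auto)
qed

text \<open>The copies of \<open>z\<close> contribute (n - r)! to each coefficient and the expansion
  contributes r!, where n is \<open>card E\<close>; their product is n! divided by the binomial
  coefficient, which is the source of the normalisation.\<close>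

lemma iterated_sum_potts_coeff:
  assumes z: "z \<notin> E" and w: "w z = 0" and q: "0 < q" and r: "r \<le> card E"
  shows "iterated_sum (insert z E) w (potts_coeff z indep q) r (replicate_mset (card E - r) z)
    = fact (card E) * (potts_Z E indep r q w / real (card E choose r))"
proof -
  have "iterated_sum (insert z E) w (potts_coeff z indep q) r (replicate_mset (card E - r) z)
    = fact r * (\<Sum>B | B \<subseteq> E \<and> card B = r.
        potts_coeff z indep q (replicate_mset (card E - r) z + mset_set B) * (\<Prod>i\<in>B. w i))"
    using z by (intro iterated_sum_eq_sum_subsets finite_ground w) (metis potts_coeff_repeated)+
  also have "(\<Sum>B | B \<subseteq> E \<and> card B = r.
        potts_coeff z indep q (replicate_mset (card E - r) z + mset_set B) * (\<Prod>i\<in>B. w i))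
    = fact (card E - r) * potts_Z E indep r q w"
    unfolding potts_Z_def sum_distrib_left
  proof (rule sum.cong[OF refl])
    fix B assume B: "B \<in> {B. B \<subseteq> E \<and> card B = r}"
    then have fin: "finite B" and zB: "z \<notin> B" using finite_subset_ground z by auto
    have "set_mset (replicate_mset (card E - r) z + mset_set B) - {z} = B"
      using fin zB by auto
    then show "potts_coeff z indep q (replicate_mset (card E - r) z + mset_set B) * (\<Prod>i\<in>B. w i)
        = fact (card E - r) * (q powi (- int (matroid_rank indep B)) * (\<Prod>i\<in>B. w i))"
      using fin zB by (simp add: potts_coeff_def count_mset_set')
  qed
  also have "fact r * (fact (card E - r) * potts_Z E indep r q w)
      = fact (card E) * (potts_Z E indep r q w / real (card E choose r))"
    using binomial_fact[OF r, where 'a = real] by simp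
  finally show ?thesis .
qed

theorem potts_Z_ultra_log_concave:
  assumes z: "z \<notin> E" and m: "0 < m" "m < card E" and q: "0 < q" "q \<le> 1"
    and w: "\<And>i. i \<in> E \<Longrightarrow> w i \<ge> 0"
  shows "potts_Z E indep (m + 1) q w / real (card E choose (m + 1))
      * (potts_Z E indep (m - 1) q w / real (card E choose (m - 1)))
    \<le> (potts_Z E indep m q w / real (card E choose m))\<^sup>2"
proof -
  \<comment> \<open>The value of \<open>w\<close> at \<open>z\<close> is arbitrary and is reset to
    0. The shift by \<open>t\<close> supplies the strict positivity that
    \<open>reverse_cauchy_iterated_sum\<close> needs and disappears in the limit.\<close>
  define w0 where "w0 = w(z := 0)"
  define W where "W = (\<lambda>t i. w0 i + t)"
  define I where "I = insert z E"
  define G where "G = (\<lambda>t r. iterated_sum I (W t) (potts_coeff z indep q) r (replicate_mset (card E - r) z))"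
  have I: "finite I" "z \<in> I" using finite_ground by (auto simp: I_def)
  have ineq: "G t (m - 1) * G t (m + 1) \<le> (G t m)\<^sup>2" if t: "t > 0" for t
  proof -
    have Wpos: "W t i > 0" if "i \<in> I" for i
      using that t w by (auto simp: W_def w0_def I_def add_nonneg_pos)
    \<comment> \<open>These derivatives leave degree \<open>m + 1\<close>: two for the matrix
      indices and \<open>m - 1\<close> for the evaluation at \<open>W t\<close>.\<close>
    define X where "X = replicate_mset (card E - (m + 1)) z"
    let ?H = "iterated_sum I (W t) (potts_coeff z indep q)"
    have "reverse_cauchy I (\<lambda>i j. W t i * W t j * ?H (m - 1) (add_mset i (add_mset j X)))"
    proof (rule reverse_cauchy_iterated_sum[where z = z and g = "potts_coeff z indep q" and w = "W t" and d = "card E - 2"])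
      show "reverse_cauchy I (\<lambda>i j. W t i * W t j * potts_coeff z indep q (add_mset i (add_mset j Y)))"
        if "set_mset Y \<subseteq> I" "size Y = card E - 2" for Y
        using reverse_cauchy_potts_base[OF z q, of "W t" Y] that Wpos m by (simp add: I_def)
      show "potts_coeff z indep q Y \<ge> 0" for Y by (rule potts_coeff_nonneg[OF q(1)])
      show "potts_coeff z indep q (add_mset z Y) > 0" if "potts_coeff z indep q (add_mset k Y) > 0" for k Y
        by (rule potts_coeff_hub[OF q(1) that])
      show "set_mset X \<subseteq> I" using I by (auto simp: X_def)
      show "size X + (m - 1) = card E - 2" using m by (simp add: X_def)
    qed (use I Wpos in auto)
    then have rc: "bilin I (\<lambda>i j. W t i * W t j * ?H (m - 1) (add_mset i (add_mset j X))) x x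
        * bilin I (\<lambda>i j. W t i * W t j * ?H (m - 1) (add_mset i (add_mset j X))) (\<lambda>_. 1) (\<lambda>_. 1)
      \<le> (bilin I (\<lambda>i j. W t i * W t j * ?H (m - 1) (add_mset i (add_mset j X))) x (\<lambda>_. 1))\<^sup>2" for x
      by (simp add: reverse_cauchy_def)
    have m1: "Suc (m - 1) = m" using m by simp
    have "card E - m = Suc (card E - (m + 1))" "card E - (m - 1) = Suc (Suc (card E - (m + 1)))"
      using m by linarith+
    then have rep: "replicate_mset (card E - m) z = add_mset z X"
      "replicate_mset (card E - (m - 1)) z = add_mset z (add_mset z X)"
      by (simp_all add: X_def)
    \<comment> \<open>Dividing by \<open>W t z\<close> cancels the weight of row \<open>z\<close>.
      Pairing \<open>?e\<close> with itself, \<open>?e\<close> with all ones, and all ones with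
      itself then gives \<open>G t\<close> at \<open>m - 1\<close>, \<open>m\<close> and
      \<open>m + 1\<close>.\<close>
    let ?e = "\<lambda>i. if i = z then 1 / W t z else 0"
    have wz: "W t z \<noteq> 0" using Wpos[OF I(2)] by simp
    have sum1: "(\<Sum>i\<in>I. W t i * ?H (m - 1) (add_mset i Y)) = ?H m Y" for Y
      by (subst (2) m1[symmetric]) simp
    have bile: "bilin I (\<lambda>i j. W t i * W t j * ?H (m - 1) (add_mset i (add_mset j X))) ?e y
        = (\<Sum>j\<in>I. W t j * ?H (m - 1) (add_mset j (add_mset z X)) * y j)" for y
    proof -
      have "bilin I (\<lambda>i j. W t i * W t j * ?H (m - 1) (add_mset i (add_mset j X))) ?e y
        = (\<Sum>i\<in>I. if i = z then \<Sum>j\<in>I. W t j * ?H (m - 1) (add_mset z (add_mset j X)) * y j else 0)"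
        unfolding bilin_def using wz by (intro sum.cong refl) auto
      then show ?thesis using I by (simp add: add_mset_commute[of z])
    qed
    have "bilin I (\<lambda>i j. W t i * W t j * ?H (m - 1) (add_mset i (add_mset j X))) ?e ?e = G t (m - 1)"
    proof -
      have "(\<Sum>j\<in>I. W t j * ?H (m - 1) (add_mset j (add_mset z X)) * ?e j)
        = (\<Sum>j\<in>I. if j = z then ?H (m - 1) (add_mset z (add_mset z X)) else 0)"
        using wz by (intro sum.cong refl) auto
      then show ?thesis unfolding bile using I by (simp add: G_def rep del: One_nat_def)
    qed
    moreover have "bilin I (\<lambda>i j. W t i * W t j * ?H (m - 1) (add_mset i (add_mset j X))) ?e (\<lambda>_. 1) = G t m"
      unfolding bile using sum1[of "add_mset z X"] by (simp add: G_def rep)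
    moreover have "bilin I (\<lambda>i j. W t i * W t j * ?H (m - 1) (add_mset i (add_mset j X))) (\<lambda>_. 1) (\<lambda>_. 1) = G t (m + 1)"
    proof -
      have "(\<Sum>j\<in>I. W t i * W t j * ?H (m - 1) (add_mset i (add_mset j X))) = W t i * ?H m (add_mset i X)" for i
        unfolding sum1[symmetric] sum_distrib_left
        by (intro sum.cong refl) (simp add: add_mset_commute)
      then show ?thesis by (simp add: bilin_def G_def X_def)
    qed
    ultimately show ?thesis using rc[of ?e] by simp
  qed
  have lim: "((\<lambda>t. G t r) \<longlongrightarrow> G 0 r) (at_right 0)" for r
    unfolding G_def by (intro tendsto_iterated_sum) (auto simp: W_def intro!: tendsto_eq_intros)
  have G0: "G 0 r = fact (card E) * (potts_Z E indep r q w / real (card E choose r))" if "r \<le> card E" for r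
  proof -
    have "potts_Z E indep r q (W 0) = potts_Z E indep r q w"
      unfolding potts_Z_def using z by (intro sum.cong prod.cong arg_cong2[where f = "(*)"] refl) (auto simp: W_def w0_def)
    then show ?thesis
      using iterated_sum_potts_coeff[OF z _ q(1) that, of "W 0"] by (simp add: G_def I_def W_def w0_def)
  qed
  have "G 0 (m - 1) * G 0 (m + 1) \<le> (G 0 m)\<^sup>2"
  proof (rule tendsto_le[OF _ tendsto_power[OF lim] tendsto_mult[OF lim lim]])
    show "\<forall>\<^sub>F t in at_right 0. G t (m - 1) * G t (m + 1) \<le> (G t m)\<^sup>2"
      using eventually_at_right_less by (rule eventually_mono) (rule ineq)
  qed simp
  then have "(fact (card E))\<^sup>2 * (potts_Z E indep (m + 1) q w / real (card E choose (m + 1))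
      * (potts_Z E indep (m - 1) q w / real (card E choose (m - 1))))
    \<le> (fact (card E))\<^sup>2 * (potts_Z E indep m q w / real (card E choose m))\<^sup>2"
    using m by (simp add: G0 power2_eq_square mult_ac)
  then show ?thesis by (rule mult_left_le_imp_le) simp
qed

end

theorem corollary6:
  fixes n m :: nat and indep :: "nat set \<Rightarrow> bool" and q :: real and w :: "nat \<Rightarrow> real"
  assumes "n \<ge> 2"
    and "matroid {1..n} indep"
    and "0 < m" and "m < n"
    and "0 < q" and "q \<le> 1"
    and "\<And>i. i \<in> {1..n} \<Longrightarrow> w i \<ge> 0"
  shows "(potts_Z {1..n} indep m q w)\<^sup>2 / (real (n choose m))\<^sup>2
    \<ge> potts_Z {1..n} indep (m + 1) q w / real (n choose (m + 1))
      * (potts_Z {1..n} indep (m - 1) q w / real (n choose (m - 1)))"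
  \<comment> \<open>The index 0 lies outside \<open>{1..n}\<close> and serves as the homogenising
    variable.\<close>
  using matroid.potts_Z_ultra_log_concave[OF assms(2), of 0 m q w] assms(3-7)
  by (simp add: power_divide)

end
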